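(* For $k\in\{1,2,3\}$, let $\Phi^{(4,k)}:M_4\to M_4$ be defined by $\Phi^{(4,k)}([a_{ij}])=\operatorname{diag}(b_1,\dots,b_4)-[a_{ij}]$ with $b_i=3a_{ii}+a_{\sigma_k(i),\sigma_k(i)}$, where $\sigma_k(i)\equiv i+k\pmod 4$, $\sigma_k(i)\in\{1,2,3,4\}$. Then $\Phi^{(4,k)}$ is an extremal positive linear map if and only if $k=1$ or $k=3$.
   Context: A linear map $\phi:M_n\to M_n$ is positive if it maps positive semidefinite matrices to positive semidefinite matrices. A positive linear map $\phi$ is extremal if whenever $\phi=\phi_1+\phi_2$ with $\phi_1,\phi_2$ positive linear maps, there are nonnegative reals $\lambda_i$ with $\phi_i=\lambda_i\phi$. *)

theory Defs
  imports "HOL-Analysis.Analysis" "HOL-Library.Numeral_Type" "HOL-Library.Complex_Order"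
begin

text \<open>Complex n x n matrices are represented as complex^'n^'n (entry A$i$j).
  For M_4 the index type is the numeral type 4 = {0,1,2,3}, with arithmetic mod 4.\<close>

definition mat_adjoint :: "complex^'n^'n \<Rightarrow> complex^'n^'n" where
  "mat_adjoint A = (\<chi> i j. cnj (A$j$i))"

definition psd :: "complex^'n::finite^'n \<Rightarrow> bool" where
  "psd A \<longleftrightarrow> mat_adjoint A = A \<and>
     (\<forall>x::complex^'n. 0 \<le> (\<Sum>i\<in>UNIV. \<Sum>j\<in>UNIV. cnj (x$i) * A$i$j * x$j))"

definition mscale :: "complex \<Rightarrow> complex^'n^'m \<Rightarrow> complex^'n^'m" where
  "mscale c A = (\<chi> i j. c * A$i$j)"

definition clinear_map :: "(complex^'n^'n \<Rightarrow> complex^'n^'n) \<Rightarrow> bool" where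
  "clinear_map \<phi> \<longleftrightarrow> (\<forall>A B. \<phi> (A + B) = \<phi> A + \<phi> B) \<and> (\<forall>c A. \<phi> (mscale c A) = mscale c (\<phi> A))"

definition positive_map :: "(complex^'n::finite^'n \<Rightarrow> complex^'n^'n) \<Rightarrow> bool" where
  "positive_map \<phi> \<longleftrightarrow> (\<forall>A. psd A \<longrightarrow> psd (\<phi> A))"

definition extremal_positive :: "(complex^'n::finite^'n \<Rightarrow> complex^'n^'n) \<Rightarrow> bool" where
  "extremal_positive \<phi> \<longleftrightarrow> clinear_map \<phi> \<and> positive_map \<phi> \<and>
     (\<forall>\<phi>1 \<phi>2. clinear_map \<phi>1 \<and> positive_map \<phi>1 \<and> clinear_map \<phi>2 \<and> positive_map \<phi>2 \<and>
        (\<forall>A. \<phi> A = \<phi>1 A + \<phi>2 A) \<longrightarrow>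
        (\<exists>l1 l2::real. l1 \<ge> 0 \<and> l2 \<ge> 0 \<and>
           (\<forall>A. \<phi>1 A = mscale (complex_of_real l1) (\<phi> A)) \<and>
           (\<forall>A. \<phi>2 A = mscale (complex_of_real l2) (\<phi> A))))"

definition Phi4 :: "nat \<Rightarrow> complex^4^4 \<Rightarrow> complex^4^4" where
  "Phi4 k A = (\<chi> i j. (if i = j then 3 * A$i$i + A$(i + of_nat k)$(i + of_nat k) else 0) - A$i$j)"

end

theory Submission
  imports Defs
begin

text \<open>
  Let \<open>s = k mod 4\<close>. A linear map \<open>\<psi>\<close> is encoded by its coefficients
  \<open>c j k l m = \<psi>(E\<^sub>j\<^sub>k)\<^sub>l\<^sub>m\<close>, and positivity of \<open>\<psi>\<close> on rank-one matrices says that the form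
  \<open>F(x,y) = y\<^sup>* \<psi>(x x\<^sup>*) y\<close> is nonnegative. For \<open>\<Phi>\<close> this form is
  \<open>G(x,y) = \<Sum>\<^sub>i (3|x\<^sub>i|\<^sup>2 + |x\<^bsub>i+s\<^esub>|\<^sup>2)|y\<^sub>i|\<^sup>2 - |\<Sum>\<^sub>i x\<^sub>i cnj y\<^sub>i|\<^sup>2\<close>.

  Extremality for odd \<open>k\<close>: let \<open>0 \<le> F \<le> G\<close>. Every zero of \<open>G\<close> is a minimum of \<open>F\<close>, so the
  derivatives of \<open>F\<close> vanish there. The zeros \<open>x = y\<close> on the torus \<open>|x\<^sub>i| = 1\<close>, together with
  \<open>y = e\<^sub>m\<close>, \<open>x \<perp> e\<^sub>m, e\<^bsub>m+s\<^esub>\<close>, leave only the coefficients already present in \<open>G\<close>, and show that the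
  coefficient of \<open>|x\<^bsub>l+s\<^esub>|\<^sup>2|y\<^sub>l|\<^sup>2\<close> is a constant \<open>\<beta>\<close>. For the rest one uses zeros at infinity:
  let \<open>|x\<^bsub>l+s\<^esub>| |y\<^sub>l| / |x\<^sub>l y\<^sub>l|\<close> tend to \<open>0\<close> for three of the four
  indices, keeping \<open>x\<^sub>i cnj y\<^sub>i\<close> fixed. In the limit the quadratic form of
  \<open>(c l m l m)\<^sub>l\<^sub>m\<close> on three coordinates lies between \<open>0\<close> and \<open>3I - J\<close>,
  hence annihilates the all-ones vector, and this fixes all remaining coefficients in terms of \<open>\<beta>\<close>.

  Positivity for odd \<open>k\<close> reduces by the Cauchy-Schwarz inequality to
  \<open>\<Sum>\<^sub>i a\<^sub>i / (3 a\<^sub>i + a\<^bsub>i+s\<^esub>) \<le> 1\<close>, which follows from the inequality of arithmetic and geometric means.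
  For \<open>k = 2\<close> the map is the sum of a completely positive and a completely copositive map.
\<close>

section \<open>Index arithmetic, null vectors of forms, Fourier coefficients on the torus\<close>

lemma mod4: "(5::4) = 1" "(6::4) = 2" "(7::4) = 3"
  by simp_all

text \<open>Near \<open>t = 0\<close> the linear part outweighs the quadratic one, so its real part
  vanishes for real and for imaginary \<open>t\<close>. Nonnegative values are also real; comparing
  \<open>t\<close> with \<open>- t\<close> kills the imaginary part.\<close>

lemma linear_term_zero:
  fixes a b d :: complex
  assumes "\<And>t. 0 \<le> cnj t * a + t * b + cnj t * t * d"
  shows "a = 0"
proof -
  have lin: "p = 0" if nonneg: "\<And>r. 0 \<le> r * p + r\<^sup>2 * q" for p q :: real
  proof (rule ccontr)
    assume "p \<noteq> 0"
    \<comment> \<open>Since \<open>D\<close> is positive and exceeds \<open>q\<close>, at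
      \<open>r = - p / D\<close> the quadratic term cannot compensate the linear term
      \<open>- p^2 / D\<close>.\<close>
    define D where "D = \<bar>q\<bar> + 1"
    have D: "D > 0" "q < D" by (auto simp: D_def)
    have "(- p / D) * p + (- p / D)\<^sup>2 * q = p\<^sup>2 * (q - D) / D\<^sup>2"
      using D by (simp add: field_simps power2_eq_square)
    also have "\<dots> < 0" using D \<open>p \<noteq> 0\<close> by (intro divide_neg_pos mult_pos_neg) auto
    finally show False using nonneg[of "- p / D"] by simp
  qed
  have "Re (a + b) = 0"
    by (rule lin[of _ "Re d"])
      (use assms[of "complex_of_real r" for r] in \<open>simp add: less_eq_complex_def algebra_simps power2_eq_square\<close>)
  moreover have "Im (a - b) = 0"
    by (rule lin[of _ "Re d"])
      (use assms[of "\<i> * complex_of_real r" for r] in \<open>simp add: less_eq_complex_def algebra_simps power2_eq_square\<close>)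
  moreover have "Im (a + b) = 0"
    using assms[of 1] assms[of "-1"] by (simp add: less_eq_complex_def)
  moreover have "Re (a - b) = 0"
    using assms[of \<i>] assms[of "-\<i>"] by (simp add: less_eq_complex_def)
  ultimately show ?thesis by (simp add: complex_eq_iff)
qed

text \<open>Adding \<open>t\<close> to coordinate \<open>l\<close> of \<open>y\<close> leaves no
  constant term, and the coefficient of \<open>cnj t\<close> is the \<open>l\<close>-th entry of
  \<open>B y\<close>; \<open>linear_term_zero\<close> applies.\<close>

lemma nonneg_form_kernel:
  fixes B :: "'n::finite \<Rightarrow> 'n \<Rightarrow> complex"
  assumes nonneg: "\<And>y. 0 \<le> (\<Sum>l\<in>UNIV. \<Sum>m\<in>UNIV. B l m * cnj (y l) * y m)"
    and zero: "(\<Sum>l\<in>UNIV. \<Sum>m\<in>UNIV. B l m * cnj (y l) * y m) = 0"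
  shows "(\<Sum>m\<in>UNIV. B l m * y m) = 0"
proof (rule linear_term_zero)
  fix t :: complex
  let ?b = "\<Sum>i\<in>UNIV. B i l * cnj (y i)"
  have 1: "(\<Sum>m\<in>UNIV. B i m * cnj (y i + (if i = l then t else 0)) * (y m + (if m = l then t else 0)))
     = (\<Sum>m\<in>UNIV. B i m * cnj (y i) * y m) + t * (B i l * cnj (y i))
       + (if i = l then cnj t * (\<Sum>m\<in>UNIV. B l m * y m) + cnj t * t * B l l else 0)" for i
    by (auto simp: algebra_simps sum.distrib sum_distrib_left if_distrib[of "\<lambda>z. _ * z"] cong: if_cong)
  have "(\<Sum>i\<in>UNIV. \<Sum>m\<in>UNIV. B i m * cnj (y i + (if i = l then t else 0)) * (y m + (if m = l then t else 0)))
    = (\<Sum>i\<in>UNIV. \<Sum>m\<in>UNIV. B i m * cnj (y i) * y m) + t * ?b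
      + (cnj t * (\<Sum>m\<in>UNIV. B l m * y m) + cnj t * t * B l l)"
    unfolding 1 by (simp add: sum.distrib sum_distrib_left)
  with nonneg[of "\<lambda>i. y i + (if i = l then t else 0)"] zero
  show "0 \<le> cnj t * (\<Sum>m\<in>UNIV. B l m * y m) + t * ?b + cnj t * t * B l l"
    by (simp add: add_ac)
qed

text \<open>The exponents 2, 1, 0, -1 are distinct modulo 4, so the values at the fourth roots of
  unity determine the coefficients.\<close>

lemma circle_coeffs_zero:
  fixes a b d e :: complex
  assumes "\<And>z. cmod z = 1 \<Longrightarrow> a * z\<^sup>2 + b * z + d + e * cnj z = 0"
  shows "a = 0" "b = 0" "d = 0" "e = 0"
proof -
  have "a + b + d + e = 0" "a - b + d - e = 0" 
    "- a + \<i> * b + d - \<i> * e = 0" "- a - \<i> * b + d + \<i> * e = 0"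
    using assms[of 1] assms[of "-1"] assms[of \<i>] assms[of "-\<i>"] by (simp_all add: algebra_simps)
  then show "a = 0" "b = 0" "d = 0" "e = 0"
    by (simp_all add: complex_eq_iff)
qed

text \<open>A trigonometric polynomial vanishing on the torus has zero Fourier coefficients, here
  that of \<open>x j * cnj (x p) * x m\<close> (twice it if \<open>j = m\<close>). Varying
  \<open>x p\<close>, then \<open>x j\<close>, then \<open>x m\<close> over the circle isolates
  it.\<close>

lemma torus_cubic_zero:
  fixes q :: "'n::finite \<Rightarrow> 'n \<Rightarrow> 'n \<Rightarrow> complex"
  assumes zero: "\<And>x. (\<And>i. cmod (x i) = 1) \<Longrightarrow>
      (\<Sum>j\<in>UNIV. \<Sum>k\<in>UNIV. \<Sum>m\<in>UNIV. q j k m * x j * cnj (x k) * x m) = 0"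
    and "j \<noteq> p" "m \<noteq> p"
  shows "q j p m + q m p j = 0"
proof -
  let ?P = "UNIV - {p}"
  have split: "(\<Sum>j\<in>UNIV. f j) = f p + (\<Sum>j\<in>?P. f j)" for f :: "'n \<Rightarrow> complex"
    by (simp add: sum.remove)
  have quad: "(\<Sum>j\<in>?P. \<Sum>m\<in>?P. q j p m * x j * x m) = 0" (is "?D x = 0")
    if x: "\<And>i. cmod (x i) = 1" for x
  proof (rule circle_coeffs_zero(4))
    fix z :: complex assume "cmod z = 1"
    \<comment> \<open>After \<open>z * cnj z = 1\<close>, a factor \<open>cnj z\<close> survives
      exactly in the terms with \<open>k = p\<close> and \<open>j\<close>, \<open>m\<close>
      different from \<open>p\<close>.\<close>
    have zz: "z * cnj z = 1" using \<open>cmod z = 1\<close> complex_norm_square[of z] by simp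
    then have zz': "z * (cnj z * w) = w" for w by (simp flip: mult.assoc)
    have *: "(x(p := z)) i = x i" if "i \<in> ?P" for i using that by simp
    have "(\<Sum>j\<in>UNIV. \<Sum>k\<in>UNIV. \<Sum>m\<in>UNIV. q j k m * (x(p:=z)) j * cnj ((x(p:=z)) k) * (x(p:=z)) m) = 0"
      by (rule zero) (use \<open>cmod z = 1\<close> x in auto)
    then show "(\<Sum>k\<in>?P. q p k p * cnj (x k)) * z\<^sup>2
        + (q p p p + (\<Sum>k\<in>?P. \<Sum>m\<in>?P. (q p k m * cnj (x k) * x m)) + (\<Sum>j\<in>?P. \<Sum>k\<in>?P. q j k p * x j * cnj (x k))) * z
        + ((\<Sum>m\<in>?P. q p p m * x m) + (\<Sum>j\<in>?P. q j p p * x j) + (\<Sum>j\<in>?P. \<Sum>k\<in>?P. \<Sum>m\<in>?P. q j k m * x j * cnj (x k) * x m))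
        + ?D x * cnj z = 0"
      unfolding split by (simp add: * sum.distrib cong: sum.cong)
        (simp add: sum_distrib_left sum_distrib_right sum.distrib algebra_simps power2_eq_square zz zz')
  qed
  let ?J = "?P - {j}"
  have splitj: "(\<Sum>i\<in>?P. f i) = f j + (\<Sum>i\<in>?J. f i)" for f :: "'n \<Rightarrow> complex"
    using \<open>j \<noteq> p\<close> by (simp add: sum.remove)
  have coeff: "q j p j = 0 \<and> (\<Sum>m\<in>?J. (q j p m + q m p j) * x m) = 0" 
    if x: "\<And>i. cmod (x i) = 1" for x
  proof -
    have "q j p j * z\<^sup>2 + (\<Sum>m\<in>?J. (q j p m + q m p j) * x m) * z
        + (\<Sum>i\<in>?J. \<Sum>m\<in>?J. q i p m * x i * x m) + 0 * cnj z = 0" if "cmod z = 1" for z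
    proof -
      have *: "(x(j := z)) i = x i" if "i \<in> ?J" for i using that by simp
      have "?D (x(j := z)) = 0"
        by (rule quad) (use \<open>cmod z = 1\<close> x in auto)
      then show ?thesis 
        unfolding splitj by (simp add: * sum.distrib cong: sum.cong)
        (simp add: sum_distrib_left sum_distrib_right sum.distrib algebra_simps power2_eq_square)
    qed
    from circle_coeffs_zero(1,2)[OF this] show ?thesis by blast
  qed
  show ?thesis
  proof (cases "m = j")
    case True
    then show ?thesis using coeff[of "\<lambda>_. 1"] by simp
  next
    case False
    show ?thesis
    proof (rule circle_coeffs_zero(2))
      fix z :: complex assume "cmod z = 1"
      have "(\<Sum>i\<in>?J. (q j p i + q i p j) * ((\<lambda>_. 1)(m := z)) i) = 0"
        using coeff[of "(\<lambda>_. 1)(m := z)"] \<open>cmod z = 1\<close> by auto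
      moreover have "(\<Sum>i\<in>?J. f i) = f m + (\<Sum>i\<in>?J - {m}. f i)" for f :: "'n \<Rightarrow> complex"
        using \<open>m \<noteq> p\<close> False by (simp add: sum.remove)
      moreover have "(\<Sum>i\<in>?J - {m}. (q j p i + q i p j) * ((\<lambda>_. 1)(m := z)) i)
          = (\<Sum>i\<in>?J - {m}. q j p i + q i p j)"
        by (rule sum.cong) auto
      ultimately show "0 * z\<^sup>2 + (q j p m + q m p j) * z + (\<Sum>i\<in>?J - {m}. q j p i + q i p j) + 0 * cnj z = 0"
        by simp
    qed
  qed
qed

section \<open>Biquadratic forms dominated by that of the map\<close>

definition tform :: "('n::finite \<Rightarrow> 'n \<Rightarrow> 'n \<Rightarrow> 'n \<Rightarrow> complex) \<Rightarrow> ('n \<Rightarrow> complex) \<Rightarrow> ('n \<Rightarrow> complex) \<Rightarrow> complex" where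
  "tform c x y = (\<Sum>j\<in>UNIV. \<Sum>k\<in>UNIV. \<Sum>l\<in>UNIV. \<Sum>m\<in>UNIV. c j k l m * x j * cnj (x k) * cnj (y l) * y m)"

lemma tform_swap:
  "tform c x y = (\<Sum>l\<in>UNIV. \<Sum>m\<in>UNIV. (\<Sum>j\<in>UNIV. \<Sum>k\<in>UNIV. c j k l m * x j * cnj (x k)) * cnj (y l) * y m)"
  unfolding tform_def sum_distrib_right sum.cartesian_product
  by (rule sum.reindex_bij_witness[where i = "\<lambda>(l, m, j, k). (j, k, l, m)" 
        and j = "\<lambda>(j, k, l, m). (l, m, j, k)"]) auto

text \<open>These are the coefficients of the dual map for the pairing
  \<open>Tr (\<psi>(A) B)\<close>; duality exchanges \<open>x\<close> and \<open>y\<close> and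
  yields a twin of each later fact.\<close>

lemma tform_rev: "tform (\<lambda>j k l m. c m l k j) y x = tform c x y"
  unfolding tform_def sum.cartesian_product
  by (rule sum.reindex_bij_witness[where i = "\<lambda>(j, k, l, m). (m, l, k, j)" 
        and j = "\<lambda>(j, k, l, m). (m, l, k, j)"]) auto

lemma tform_cnj: "tform (\<lambda>j k l m. cnj (c k j m l)) x y = cnj (tform c x y)"
  unfolding tform_def sum.cartesian_product cnj_sum
  by (rule sum.reindex_bij_witness[where i = "\<lambda>(j, k, l, m). (k, j, m, l)" 
        and j = "\<lambda>(j, k, l, m). (k, j, m, l)"]) auto

text \<open>\<open>gform s x y\<close> is \<open>y\<^sup>* \<Phi>(x x\<^sup>*) y\<close>.\<close>
definition gform :: "4 \<Rightarrow> (4 \<Rightarrow> complex) \<Rightarrow> (4 \<Rightarrow> complex) \<Rightarrow> real" where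
  "gform s x y = (\<Sum>i\<in>UNIV. (3 * (cmod (x i))\<^sup>2 + (cmod (x (i + s)))\<^sup>2) * (cmod (y i))\<^sup>2)
     - (cmod (\<Sum>i\<in>UNIV. x i * cnj (y i)))\<^sup>2"

lemma gform_rev: "gform (- s) y x = gform s x y"
proof -
  have "(\<Sum>i\<in>UNIV. (cmod (y (i - s)))\<^sup>2 * (cmod (x i))\<^sup>2) = (\<Sum>i\<in>UNIV. (cmod (x (i + s)))\<^sup>2 * (cmod (y i))\<^sup>2)"
    by (rule sum.reindex_bij_witness[where i = "\<lambda>i. i + s" and j = "\<lambda>i. i - s"]) auto
  moreover have "(\<Sum>i\<in>UNIV. y i * cnj (x i)) = cnj (\<Sum>i\<in>UNIV. x i * cnj (y i))"
    by (simp add: mult.commute)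
  then have "cmod (\<Sum>i\<in>UNIV. y i * cnj (x i)) = cmod (\<Sum>i\<in>UNIV. x i * cnj (y i))"
    by (simp only: complex_mod_cnj)
  ultimately show ?thesis
    by (simp add: gform_def algebra_simps sum.distrib)
qed

definition dominated :: "4 \<Rightarrow> (4 \<Rightarrow> 4 \<Rightarrow> 4 \<Rightarrow> 4 \<Rightarrow> complex) \<Rightarrow> bool" where
  "dominated s c \<longleftrightarrow> (\<forall>x y. 0 \<le> tform c x y \<and> tform c x y \<le> complex_of_real (gform s x y))"

lemma dominated_rev: "dominated s c \<Longrightarrow> dominated (- s) (\<lambda>j k l m. c m l k j)"
  unfolding dominated_def by (metis tform_rev gform_rev)

lemma dominated_cnj: "dominated s c \<Longrightarrow> dominated s (\<lambda>j k l m. cnj (c k j m l))"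
  unfolding dominated_def tform_cnj by (simp add: less_eq_complex_def)

text \<open>At a zero of \<open>gform\<close> the value of \<open>tform\<close> is squeezed to 0, so
  \<open>y\<close> is a null vector of the nonnegative form of the image of
  \<open>x x*\<close>.\<close>

lemma dominated_kernel:
  assumes "dominated s c" "gform s x y = 0"
  shows "(\<Sum>j\<in>UNIV. \<Sum>k\<in>UNIV. \<Sum>m\<in>UNIV. c j k l m * x j * cnj (x k) * y m) = 0"
proof -
  have "(\<Sum>m\<in>UNIV. (\<Sum>j\<in>UNIV. \<Sum>k\<in>UNIV. c j k l m * x j * cnj (x k)) * y m) = 0"
  proof (rule nonneg_form_kernel)
    show "0 \<le> (\<Sum>l\<in>UNIV. \<Sum>m\<in>UNIV. (\<Sum>j\<in>UNIV. \<Sum>k\<in>UNIV. c j k l m * x j * cnj (x k)) * cnj (y l) * y m)" for y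
      using assms(1)[unfolded dominated_def, THEN spec, THEN spec, THEN conjunct1, of x y] by (simp only: tform_swap)
    show "(\<Sum>l\<in>UNIV. \<Sum>m\<in>UNIV. (\<Sum>j\<in>UNIV. \<Sum>k\<in>UNIV. c j k l m * x j * cnj (x k)) * cnj (y l) * y m) = 0"
      using assms(1)[unfolded dominated_def, THEN spec, THEN spec, of x y] assms(2)
      by (simp only: tform_swap of_real_0 order_antisym)
  qed
  also have "(\<Sum>m\<in>UNIV. (\<Sum>j\<in>UNIV. \<Sum>k\<in>UNIV. c j k l m * x j * cnj (x k)) * y m)
     = (\<Sum>j\<in>UNIV. \<Sum>k\<in>UNIV. \<Sum>m\<in>UNIV. c j k l m * x j * cnj (x k) * y m)"
    unfolding sum_distrib_right sum.cartesian_product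
    by (rule sum.reindex_bij_witness[where i = "\<lambda>(j, k, m). (m, j, k)" 
        and j = "\<lambda>(m, j, k). (j, k, m)"]) auto
  finally show ?thesis .
qed

lemma gform_torus:
  assumes "\<And>i. cmod (x i) = 1"
  shows "gform s x x = 0"
proof -
  have "x i * cnj (x i) = 1" for i using complex_norm_square[of "x i"] assms by simp
  then show ?thesis by (simp add: gform_def assms sum_4)
qed

text \<open>At the torus zeros \<open>x = y\<close> the kernel relation is a cubic in
  \<open>x\<close>, to which \<open>torus_cubic_zero\<close> applies.\<close>

lemma dominated_antisym14:
  assumes "dominated s c" "j \<noteq> p" "m \<noteq> p"
  shows "c j p l m = - c m p l j"
proof -
  have "c j p l m + c m p l j = 0"
    by (rule torus_cubic_zero[where q = "\<lambda>j k m. c j k l m"])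
      (use assms dominated_kernel gform_torus in \<open>blast+\<close>)
  then show ?thesis by (simp add: add_eq_0_iff)
qed

text \<open>For \<open>y = e_m\<close>, \<open>gform\<close> vanishes whenever \<open>x\<close> is
  zero at \<open>m\<close> and \<open>m + s\<close>, which leaves \<open>x\<close> free on the other
  two coordinates.\<close>

lemma dominated_off_zero:
  assumes dom: "dominated s c" and "j \<notin> {m, m + s}" "k \<notin> {m, m + s}"
  shows "c j k l m = 0"
proof -
  have ker: "(\<Sum>j\<in>UNIV. (\<Sum>k\<in>UNIV. c j k l m * cnj (x k)) * x j) = 0" if "x m = 0" "x (m + s) = 0" for x
  proof -
    let ?y = "\<lambda>i. if i = m then 1 else 0"
    have *: "(3 * (cmod (x i))\<^sup>2 + (cmod (x (i + s)))\<^sup>2) * (cmod (?y i))\<^sup>2 = 0" for i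
      using that by auto
    have **: "x i * cnj (?y i) = 0" for i using that by auto
    have "gform s x ?y = 0" unfolding gform_def * ** by simp
    from dominated_kernel[OF dom this, of l]
    show ?thesis by (simp add: mult_delta_right sum_distrib_left mult_ac)
  qed
  show ?thesis
  proof (cases "j = k")
    case True
    with assms have "(\<lambda>i. if i = j then 1 else 0::complex) m = 0"
      "(\<lambda>i. if i = j then 1 else 0::complex) (m + s) = 0"
      by auto
    from ker[OF this] True show ?thesis
      by (simp add: if_distrib[of cnj] mult_delta_left mult_delta_right cong: if_cong)
  next
    case False
    show ?thesis
    proof (rule circle_coeffs_zero(2))
      \<comment> \<open>The test vector \<open>x = z e_j + e_k\<close> makes
        \<open>c j k l m\<close> the coefficient of \<open>z\<close>.\<close>
      fix z :: complex assume "cmod z = 1"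
      then have zz: "z * cnj z = 1" using complex_norm_square[of z] by simp
      have "(\<lambda>i. (if i = j then z else 0) + (if i = k then 1 else 0)) m = 0"
        "(\<lambda>i. (if i = j then z else 0) + (if i = k then 1 else 0)) (m + s) = 0"
        using assms by auto
      from ker[OF this]
      have "c j k l m * z + c k j l m * cnj z + c k k l m + c j j l m * (z * cnj z) = 0"
        by (simp add: ring_distribs sum.distrib if_distrib[of cnj] mult_delta_left mult_delta_right mult_ac add_ac cong: if_cong)
      then show "0 * z\<^sup>2 + c j k l m * z + (c k k l m + c j j l m) + c k j l m * cnj z = 0"
        by (simp add: zz add_ac)
    qed
  qed
qed

section \<open>Uniqueness of dominated forms\<close>

text \<open>The shift by \<open>s\<close> is a 4-cycle, where \<open>l\<close> has a single
  non-neighbour, so \<open>j\<close> and \<open>m\<close> cannot both avoid being adjacent to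
  \<open>l\<close>.\<close>

lemma cyclic4_adjacent:
  fixes s :: 4
  assumes "s \<in> {1, 3}" "distinct [j, k, l, m]"
  shows "l = m + s \<or> m = l + s \<or> j = l + s \<or> l = j + s"
  using assms(1) exhaust_4[of j] exhaust_4[of l] exhaust_4[of m] exhaust_4[of k] assms(2)
  by (elim insertE disjE emptyE; simp)

text \<open>Torus zeros, used for \<open>c\<close>, its dual and its conjugate, give antisymmetry in
  the outer pair \<open>j, m\<close> and in the inner pair \<open>k, l\<close>, so a coincidence
  within a pair forces zero. The zeros with \<open>y = e_m\<close> and their twins treat the
  rest.\<close>

lemma dominated_vanish:
  assumes s: "s \<in> {1, 3}" and dom: "dominated s c"
    and "\<not> (j = l \<and> k = m)" "\<not> (j = k \<and> l = m \<and> (j = l \<or> j = l + s))"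
  shows "c j k l m = 0"
proof -
  note rev = dominated_rev[OF dom] and conj = dominated_cnj[OF dom]
  note anti14 = dominated_antisym14[OF dom] 
    and anti14' = dominated_antisym14[OF rev]
    and anti23 = dominated_antisym14[OF conj] and anti23' = dominated_antisym14[OF dominated_cnj[OF rev]]
  have off: "c j k l m = 0" if "j \<notin> {m, m + s}" "k \<notin> {m, m + s}" for j k l m
    using dominated_off_zero[OF dom that] .
  have off': "c j k l m = 0" if "j \<notin> {l, l + s}" "k \<notin> {l, l + s}" for j k l m
    using dominated_off_zero[OF conj, of k l j m] that by simp
  have outer: "c j k l j = 0" if "j \<noteq> k \<or> j \<noteq> l" for j k l
    using anti14[of j k j l] anti14'[of j l j k] that by auto
  have inner: "c k j j l = 0" if "j \<noteq> k \<or> j \<noteq> l" for j k l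
    using anti23[of j k j l] anti23'[of j l j k] that by auto
  have diag: "c j j l m = 0" if "l \<noteq> m" for j l m
  proof (cases "j = l \<or> j = m")
    case True
    then show ?thesis using that outer inner by auto
  next
    case False
    then show ?thesis 
    proof (cases "j = m + s")
      case True
      then have "j \<notin> {l, l + s}" using that False by auto
      then show ?thesis by (rule off'[rotated]) fact
    next
      case False': False
      show ?thesis by (rule off) (use False False' in auto)
    qed
  qed
  have diag': "c j k l l = 0" if "j \<noteq> k" for j k l
  proof (cases "l = j \<or> l = k")
    case True
    then show ?thesis using that outer inner by auto
  next
    case False
    have off_rev: "c j k l l = 0" if "l \<notin> {j, j - s}" for j k l
      using dominated_off_zero[OF rev, of l j l k] that by simp
    have off_rev': "c j k l l = 0" if "l \<notin> {k, k - s}" for j k l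
      using dominated_off_zero[OF dominated_cnj[OF rev], of l k l j] that by simp
    have "l \<noteq> j - s \<or> l \<noteq> k - s" using that by (metis diff_add_cancel)
    then show ?thesis using off_rev off_rev' False by (metis insert_iff empty_iff)
  qed
  have dist: "c j k l m = 0" if "distinct [j, k, l, m]" "l = m + s \<or> m = l + s" for j k l m
    using that off[of j m k l] off'[of j l k m] by auto
  consider "j = k" | "l = m" | "j \<noteq> k" "l \<noteq> m" "j = m \<or> k = l" 
    | "j \<noteq> k" "j = l" "k \<noteq> m" "j \<noteq> m" | "j \<noteq> k" "k = m" "j \<noteq> l" "k \<noteq> l" | "distinct [j, k, l, m]"
    using assms(3) by auto
  then show ?thesis
  proof cases
    case 1
    then show ?thesis using diag off assms by (cases "l = m") auto
  next
    case 2
    then show ?thesis using diag' off assms by (cases "j = k") auto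
  next
    case 3
    then show ?thesis using outer inner by auto
  next
    case 4
    then show ?thesis using anti14[of j k m l] diag' by auto
  next
    case 5
    then show ?thesis using anti14'[of k l j k] diag by auto
  next
    case 6
    \<comment> \<open>If \<open>l\<close> is not adjacent to \<open>m\<close>, it is adjacent to
      \<open>j\<close>, and \<open>anti14\<close> exchanges \<open>j\<close> and
      \<open>m\<close>.\<close>
    from cyclic4_adjacent[OF s 6] dist[OF 6] dist[of m k l j] anti14[of j k m l] 6
    show ?thesis by auto
  qed
qed

lemma dominated_shape:
  assumes "s \<in> {1, 3}" "dominated s c"
  shows "c j k l m = (if j = l \<and> k = m then c l m l m else 0)
      + (if j = k \<and> l = m \<and> j = l + s then c (l + s) (l + s) l l else 0)"
  using dominated_vanish[OF assms, of j l k m] assms(1) by auto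

text \<open>This is the kernel relation at the torus zero \<open>x = y = (1,1,1,1)\<close>.\<close>

lemma dominated_row_sum:
  assumes s: "s \<in> {1, 3}" and dom: "dominated s c"
  shows "(\<Sum>m\<in>UNIV. c l m l m) + c (l + s) (l + s) l l = 0"
proof -
  have "(\<Sum>j\<in>UNIV. \<Sum>k\<in>UNIV. \<Sum>m\<in>UNIV. c j k l m) = 0"
    using dominated_kernel[OF dom, of "\<lambda>_. 1" "\<lambda>_. 1" l] gform_torus[of "\<lambda>_. 1" s] by simp
  also have "(\<lambda>j k m. c j k l m) = (\<lambda>j k m. (if m = k then if j = l then c l k l k else 0 else 0)
      + (if m = l then if k = l + s then if j = l + s then c (l + s) (l + s) l l else 0 else 0 else 0))"
    by (subst dominated_shape[OF s dom]) (auto simp: fun_eq_iff)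
  then have "(\<Sum>j\<in>UNIV. \<Sum>k\<in>UNIV. \<Sum>m\<in>UNIV. c j k l m) = (\<Sum>j\<in>UNIV. \<Sum>k\<in>UNIV. \<Sum>m\<in>UNIV. (if m = k then if j = l then c l k l k else 0 else 0)
      + (if m = l then if k = l + s then if j = l + s then c (l + s) (l + s) l l else 0 else 0 else 0))"
    by metis
  also have "\<dots> = (\<Sum>k\<in>UNIV. \<Sum>j\<in>UNIV. if j = l then c l k l k else 0) + c (l + s) (l + s) l l"
    by (simp add: sum.distrib) (subst sum.swap, simp)
  finally show ?thesis by simp
qed

section \<open>Limits towards the zeros at infinity\<close>

lemma nonneg_limit:
  fixes a b :: real
  assumes "\<And>e. e > 0 \<Longrightarrow> 0 \<le> a + e\<^sup>2 * b"
  shows "0 \<le> a"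
proof (rule tendsto_lowerbound)
  show "((\<lambda>e. a + e\<^sup>2 * b) \<longlongrightarrow> a) (at_right 0)"
    by (auto intro!: tendsto_eq_intros)
  show "\<forall>\<^sub>F e in at_right 0. 0 \<le> a + e\<^sup>2 * b"
    using assms by (auto simp: eventually_at_right_less eventually_at_filter)
qed simp

lemma nonneg_limit_complex:
  fixes a b :: complex
  assumes "\<And>e::real. e > 0 \<Longrightarrow> 0 \<le> a + complex_of_real (e\<^sup>2) * b"
  shows "0 \<le> a"
proof -
  have "0 \<le> Re a" "0 \<le> Im a" "0 \<le> - Im a"
    by (rule nonneg_limit[of _ "Re b"] nonneg_limit[of _ "Im b"] nonneg_limit[of _ "- Im b"], 
        use assms in \<open>force simp: less_eq_complex_def\<close>)+
  then show ?thesis by (simp add: less_eq_complex_def)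
qed

text \<open>Taking moduli of \<open>x\<close> in geometric progression along the cycle starting after \<open>r\<close> makes all
  quotients of consecutive moduli small, except the one at \<open>r\<close>, where \<open>z\<close> vanishes.\<close>
lemma scaled_factorization:
  fixes z :: "4 \<Rightarrow> complex"
  assumes "s \<in> {1, 3}" "z r = 0" "e > (0::real)"
  obtains x y where "\<And>i. x i * cnj (y i) = z i"
    "\<And>i. cmod (x (i + s)) * cmod (y i) = e * cmod (z i)"
proof
  define u where "u i = (if i = r + s then 1 else if i = r + s + s then e else if i = r + s + s + s then e\<^sup>2 else e ^ 3)" for i
  have u: "u i > 0" for i using assms by (simp add: u_def)
  show "complex_of_real (u i) * cnj (cnj (z i) / complex_of_real (u i)) = z i" for i
    using u[of i] by simp
  have "i = r \<or> u (i + s) = e * u i" for i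
    using assms(1) exhaust_4[of i] exhaust_4[of r] 
    by (elim insertE disjE emptyE; simp add: u_def power2_eq_square power3_eq_cube)
  then have "u (i + s) * cmod (z i) = e * (u i * cmod (z i))" for i
    using assms(2) by (metis mult.assoc mult_zero_right norm_zero)
  then show "cmod (complex_of_real (u (i + s))) * cmod (cnj (z i) / complex_of_real (u i)) = e * cmod (z i)" for i
    using u[of i] u[of "i + s"] by (cases "z i = 0") (auto simp: norm_divide field_simps)
qed

text \<open>The coefficients \<open>c l m l m\<close> see \<open>x\<close> and \<open>y\<close> only
  through the products \<open>z\<close>, whereas the shifted diagonal ones acquire the factor
  \<open>e^2\<close> and disappear in the limit.\<close>

lemma tform_shape:
  assumes "s \<in> {1, 3}" "dominated s c" "\<And>i. x i * cnj (y i) = z i"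
    "\<And>i. cmod (x (i + s)) * cmod (y i) = e * cmod (z i)"
  shows "tform c x y = (\<Sum>l\<in>UNIV. \<Sum>m\<in>UNIV. c l m l m * z l * cnj (z m))
      + complex_of_real (e\<^sup>2) * (\<Sum>l\<in>UNIV. c (l + s) (l + s) l l * complex_of_real ((cmod (z l))\<^sup>2))"
proof -
  have z': "cnj (x i) * y i = cnj (z i)" for i using assms(3)[of i] by (metis complex_cnj_cnj complex_cnj_mult)
  have e: "x (l + s) * cnj (x (l + s)) * cnj (y l) * y l = complex_of_real (e\<^sup>2 * (cmod (z l))\<^sup>2)" for l
  proof -
    have "x (l + s) * cnj (x (l + s)) * cnj (y l) * y l = complex_of_real ((cmod (x (l + s)) * cmod (y l))\<^sup>2)"
      unfolding power_mult_distrib of_real_mult complex_norm_square by (simp add: mult_ac)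
    then show ?thesis unfolding assms(4) by (simp add: power_mult_distrib)
  qed
  have A: "c l m l m * x l * cnj (x m) * cnj (y l) * y m = c l m l m * z l * cnj (z m)" for l m
    by (simp add: assms(3)[symmetric] mult_ac)
  have B: "C * x (l + s) * cnj (x (l + s)) * cnj (y l) * y l = C * complex_of_real (e\<^sup>2 * (cmod (z l))\<^sup>2)" for C l
    unfolding e[symmetric] by (simp only: mult_ac)
  have "s \<noteq> 0" using assms(1) by auto
  then have *: "c j k l m * x j * cnj (x k) * cnj (y l) * y m 
      = (if k = m then if j = l then c l m l m * z l * cnj (z m) else 0 else 0)
       + (if k = j then if j = l + s then if m = l then c (l + s) (l + s) l l * complex_of_real (e\<^sup>2 * (cmod (z l))\<^sup>2) else 0 else 0 else 0)" for j k l m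
    unfolding A[symmetric] B[symmetric] dominated_shape[OF assms(1,2), of j k l m] by auto
  have "tform c x y = (\<Sum>l\<in>UNIV. \<Sum>m\<in>UNIV. \<Sum>j\<in>UNIV. \<Sum>k\<in>UNIV. c j k l m * x j * cnj (x k) * cnj (y l) * y m)"
    by (simp add: tform_swap sum_distrib_right)
  also have "\<dots> = (\<Sum>l\<in>UNIV. \<Sum>m\<in>UNIV. c l m l m * z l * cnj (z m))
      + (\<Sum>l\<in>UNIV. c (l + s) (l + s) l l * complex_of_real (e\<^sup>2 * (cmod (z l))\<^sup>2))"
    unfolding * by (simp add: sum.distrib)
  finally show ?thesis by (simp add: sum_distrib_left mult_ac)
qed

lemma gform_shape:
  assumes "\<And>i. x i * cnj (y i) = z i" "\<And>i. cmod (x (i + s)) * cmod (y i) = e * cmod (z i)"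
  shows "gform s x y = 3 * (\<Sum>i\<in>UNIV. (cmod (z i))\<^sup>2) - (cmod (\<Sum>i\<in>UNIV. z i))\<^sup>2 + e\<^sup>2 * (\<Sum>i\<in>UNIV. (cmod (z i))\<^sup>2)"
proof -
  have "(3 * (cmod (x i))\<^sup>2 + (cmod (x (i + s)))\<^sup>2) * (cmod (y i))\<^sup>2 = 3 * (cmod (z i))\<^sup>2 + e\<^sup>2 * (cmod (z i))\<^sup>2" for i
    unfolding assms(1)[symmetric] norm_mult complex_mod_cnj power_mult_distrib distrib_right
    unfolding power_mult_distrib[symmetric] assms(2) 
    by (simp add: norm_mult mult.assoc power_mult_distrib flip: assms(1))
  then show ?thesis by (simp add: gform_def assms(1) sum.distrib sum_distrib_left)
qed

text \<open>Both inequalities of \<open>dominated\<close> survive \<open>e \<rightarrow> 0\<close>.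
  One coordinate of \<open>z\<close> has to vanish because the ratios of consecutive moduli multiply
  to 1 around the cycle and cannot all be small.\<close>

lemma dominated_face_form:
  fixes z :: "4 \<Rightarrow> complex"
  assumes s: "s \<in> {1, 3}" and dom: "dominated s c" and "z r = 0"
  shows "0 \<le> (\<Sum>l\<in>UNIV. \<Sum>m\<in>UNIV. c l m l m * z l * cnj (z m))" (is "0 \<le> ?Q")
    "(\<Sum>l\<in>UNIV. \<Sum>m\<in>UNIV. c l m l m * z l * cnj (z m)) \<le> complex_of_real (3 * (\<Sum>i\<in>UNIV. (cmod (z i))\<^sup>2) - (cmod (\<Sum>i\<in>UNIV. z i))\<^sup>2)" (is "_ \<le> ?R")
proof -
  let ?K = "\<Sum>l\<in>UNIV. c (l + s) (l + s) l l * complex_of_real ((cmod (z l))\<^sup>2)"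
  let ?N = "complex_of_real (\<Sum>i\<in>UNIV. (cmod (z i))\<^sup>2)"
  have "0 \<le> ?Q + complex_of_real (e\<^sup>2) * ?K \<and> 0 \<le> (?R - ?Q) + complex_of_real (e\<^sup>2) * (?N - ?K)" if e: "e > 0" for e :: real
  proof -
    obtain x y where xy: "\<And>i. x i * cnj (y i) = z i" 
      "\<And>i. cmod (x (i + s)) * cmod (y i) = e * cmod (z i)"
      by (rule scaled_factorization[where s = s and z = z and r = r and e = e]) (use s e assms(3) in auto)
    have "0 \<le> tform c x y" "0 \<le> complex_of_real (gform s x y) - tform c x y"
      using dom by (simp_all add: dominated_def)
    then show ?thesis
      unfolding tform_shape[where x = x and y = y and z = z and e = e, OF s dom xy]
        gform_shape[where x = x and y = y and z = z and e = e, OF xy] by (simp add: algebra_simps)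
  qed
  then have "0 \<le> ?Q" "0 \<le> ?R - ?Q"
    using nonneg_limit_complex[of ?Q ?K] nonneg_limit_complex[of "?R - ?Q" "?N - ?K"] by blast+
  then show "0 \<le> ?Q" "?Q \<le> ?R" by simp_all
qed

text \<open>With coordinate \<open>r\<close> removed, the upper bound is the form of
  \<open>3I - J\<close> of size 3, which vanishes at the all-ones vector; that vector is thus null
  for the form of \<open>c\<close> as well.\<close>

lemma dominated_face_kernel:
  assumes s: "s \<in> {1, 3}" and dom: "dominated s c" and "l \<noteq> r"
  shows "(\<Sum>m\<in>UNIV - {r}. c l m l m) = 0"
proof -
  let ?B = "\<lambda>l m. if l = r \<or> m = r then 0 else c l m l m"
  have form: "(\<Sum>l\<in>UNIV. \<Sum>m\<in>UNIV. ?B l m * cnj (y l) * y m)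
     = (\<Sum>l\<in>UNIV. \<Sum>m\<in>UNIV. c l m l m * z l * cnj (z m))"
    if "z = (\<lambda>i. if i = r then 0 else cnj (y i))" for y z
    unfolding that by (intro sum.cong) auto
  have "(\<Sum>m\<in>UNIV. ?B l m * (\<lambda>_. 1) m) = 0"
  proof (rule nonneg_form_kernel)
    show "0 \<le> (\<Sum>l\<in>UNIV. \<Sum>m\<in>UNIV. ?B l m * cnj (y l) * y m)" for y
      unfolding form[OF refl] by (rule dominated_face_form(1)[OF s dom, of _ r]) simp
    have *: "(\<Sum>i\<in>UNIV. if i = r then 0 else 1) = (3::'a::comm_ring_1)"
      using exhaust_4[of r] by (auto simp: sum_4)
    have "3 * (\<Sum>i\<in>UNIV. (cmod (if i = r then 0 else cnj 1))\<^sup>2) - (cmod (\<Sum>i\<in>UNIV. if i = r then 0 else cnj 1))\<^sup>2 = 0"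
      by (simp add: * if_distrib[of cmod] if_distrib[of "\<lambda>x. x\<^sup>2"] cong: if_cong)
    then show "(\<Sum>l\<in>UNIV. \<Sum>m\<in>UNIV. ?B l m * cnj 1 * 1) = 0"
      using dominated_face_form[OF s dom, of "\<lambda>i. if i = r then 0 else cnj 1" r]
      unfolding form[OF refl, of "\<lambda>_. 1"] by (simp only: if_True refl of_real_0 order_antisym)
  qed
  moreover have "(\<Sum>m\<in>UNIV - {r}. ?B l m) = (\<Sum>m\<in>UNIV - {r}. c l m l m)"
    using \<open>l \<noteq> r\<close> by (intro sum.cong) auto
  ultimately show ?thesis
    by (simp add: sum.remove[of UNIV r])
qed

text \<open>Subtracting the row sum without \<open>r\<close> (zero) from the full row sum
  \<open>- b l\<close> gives \<open>c l r l r = - b l\<close>; the diagonal entry is then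
  \<open>2 * b l\<close>.\<close>

lemma dominated_unique:
  assumes s: "s \<in> {1, 3}" and dom: "dominated s c"
  obtains \<beta> :: real where "\<beta> \<ge> 0"
    "\<And>j k l m. c j k l m = of_real \<beta> * ((if j = k \<and> l = m then (if j = l then 3 else 0) + (if j = l + s then 1 else 0) else 0)
       - (if j = l \<and> k = m then 1 else 0))"
proof -
  define b where "b l = c (l + s) (l + s) l l" for l
  have row: "(\<Sum>m\<in>UNIV. c l m l m) = - b l" for l
    using dominated_row_sum[OF s dom, of l] by (simp add: b_def eq_neg_iff_add_eq_0)
  have s': "- s \<in> {1, 3}" using s by auto
  \<comment> \<open>The dual and the conjugate both compute the column sum; comparing them makes
    \<open>b\<close> invariant under the shift by \<open>s\<close>, which generates all
    indices.\<close>
  have "(\<Sum>m\<in>UNIV. c m l m l) = - b (l - s)" for l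
    using dominated_row_sum[OF s' dominated_rev[OF dom], of l] by (simp add: b_def eq_neg_iff_add_eq_0)
  moreover have "(\<Sum>m\<in>UNIV. c m l m l) = - b l" for l
  proof -
    have "cnj ((\<Sum>m\<in>UNIV. c m l m l) + b l) = 0"
      using dominated_row_sum[OF s dominated_cnj[OF dom], of l] by (simp add: b_def)
    then show ?thesis by (simp only: complex_cnj_zero_iff eq_neg_iff_add_eq_0)
  qed
  ultimately have "b (l - s) = b l" for l by (metis neg_equal_iff_equal)
  then have step: "b (l + s) = b l" for l by (metis add_diff_cancel_right')
  have b_const: "b l = b 1" for l
    using s exhaust_4[of l] step[of 1] step[of 2] step[of 3] step[of 4]
    by (elim insertE disjE emptyE) (simp_all add: mod4)
  have off: "c l r l r = - b 1" if "l \<noteq> r" for l r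
    using row[of l] dominated_face_kernel[OF s dom that] b_const[of l] by (simp add: sum.remove[of UNIV r])
  have diag: "c l l l l = 2 * b 1" for l
    using row[of l] off[of l] b_const[of l] exhaust_4[of l] by (auto simp: sum_4 algebra_simps)
  have "0 \<le> tform c (\<lambda>i. if i = 1 + s then 1 else 0) (\<lambda>i. if i = 1 then 1 else 0)"
    using dom by (simp add: dominated_def)
  also have "\<dots> = b 1"
    by (simp add: tform_def b_def if_distrib[of cnj] mult_delta_left mult_delta_right cong: if_cong)
  finally have b: "Re (b 1) \<ge> 0" "b 1 = of_real (Re (b 1))"
    by (auto simp: less_eq_complex_def complex_eq_iff)
  have bs: "c (l + s) (l + s) l l = b 1" for l using b_const[of l] by (simp add: b_def)
  show ?thesis
  proof
    show "Re (b 1) \<ge> 0" by (rule b)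
    show "c j k l m = of_real (Re (b 1)) * ((if j = k \<and> l = m then (if j = l then 3 else 0) + (if j = l + s then 1 else 0) else 0)
       - (if j = l \<and> k = m then 1 else 0))" for j k l m
      unfolding b(2)[symmetric] using s
      by (subst dominated_shape[OF s dom]) (auto simp: bs off diag)
  qed
qed

section \<open>Positivity\<close>

text \<open>Taking a function instead of a vector lets test points be written as lambda
  terms.\<close>

definition qform :: "complex^'n::finite^'n \<Rightarrow> ('n \<Rightarrow> complex) \<Rightarrow> complex" where
  "qform A y = (\<Sum>i\<in>UNIV. \<Sum>j\<in>UNIV. cnj (y i) * A$i$j * y j)"

lemma psd_iff:
  fixes A :: "complex^'n::finite^'n"
  shows "psd A \<longleftrightarrow> (\<forall>i j. cnj (A$j$i) = A$i$j) \<and> (\<forall>y. 0 \<le> qform A y)"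
proof -
  have "(\<forall>x::complex^'n. 0 \<le> qform A (\<lambda>i. x$i)) \<longleftrightarrow> (\<forall>y. 0 \<le> qform A y)"
  proof safe
    fix y assume "\<forall>x::complex^'n. 0 \<le> qform A (\<lambda>i. x$i)"
    from this[THEN spec, of "\<chi> i. y i"] show "0 \<le> qform A y" by simp
  qed auto
  then show ?thesis
    by (auto simp: psd_def qform_def mat_adjoint_def vec_eq_iff)
qed

lemma psd_diag:
  assumes "psd A"
  shows "0 \<le> Re (A$i$i)" "A$i$i = of_real (Re (A$i$i))"
proof -
  have "0 \<le> qform A (\<lambda>j. if j = i then 1 else 0)"
    using assms by (simp add: psd_iff)
  then have "0 \<le> A$i$i"
    by (simp add: qform_def if_distrib[of cnj] mult_delta_left mult_delta_right cong: if_cong)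
  then show "0 \<le> Re (A$i$i)" "A$i$i = of_real (Re (A$i$i))"
    by (auto simp: less_eq_complex_def complex_eq_iff)
qed

text \<open>Nonnegativity of a 2x2 principal minor, obtained by testing the form on vectors
  supported on \<open>i\<close> and \<open>j\<close>.\<close>

lemma psd_entry_bound:
  assumes "psd A"
  shows "(cmod (A$i$j))\<^sup>2 \<le> Re (A$i$i) * Re (A$j$j)"
proof (cases "i = j")
  case True
  have "cmod (A$i$i) = Re (A$i$i)"
    using psd_diag[OF assms, of i] by (metis norm_of_real abs_of_nonneg)
  with True show ?thesis by (simp add: power2_eq_square)
next
  case False
  define a b N where "a = Re (A$i$i)" "b = Re (A$j$j)" "N = (cmod (A$i$j))\<^sup>2"
  have a: "a \<ge> 0" "A$i$i = of_real a" and b: "b \<ge> 0" "A$j$j = of_real b"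
    using psd_diag[OF assms] by (auto simp: a_b_N_def)
  have herm: "A$j$i = cnj (A$i$j)" using assms by (simp add: psd_iff)
  have N: "A$i$j * cnj (A$i$j) = of_real N" 
    unfolding a_b_N_def by (rule complex_norm_square[symmetric])
  have key: "0 \<le> a * N * t\<^sup>2 + b * c\<^sup>2 - 2 * t * c * N" for t c :: real
  proof -
    \<comment> \<open>The factor \<open>A$i$j\<close> in \<open>p\<close> makes both cross terms
      equal to the real number \<open>- t * c * N\<close>.\<close>
    define p q where "p = - of_real t * A$i$j" and "q = complex_of_real c"
    let ?y = "\<lambda>l. (if l = i then p else 0) + (if l = j then q else 0)"
    have y: "cnj (?y l) = (if l = i then cnj p else 0) + (if l = j then cnj q else 0)" for l by simp
    have "qform A ?y = A$i$i * (p * cnj p) + A$j$j * (q * cnj q) + cnj p * A$i$j * q + cnj q * A$j$i * p"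
      unfolding qform_def y using False
      by (simp add: distrib_right distrib_left sum.distrib mult_delta_left mult_delta_right)
    also have "\<dots> = A$i$i * (A$i$j * cnj (A$i$j)) * of_real (t\<^sup>2) + A$j$j * of_real (c\<^sup>2)
        - 2 * of_real (t * c) * (A$i$j * cnj (A$i$j))"
      by (simp add: p_def q_def herm algebra_simps power2_eq_square)
    also have "\<dots> = of_real (a * N * t\<^sup>2 + b * c\<^sup>2 - 2 * t * c * N)"
      unfolding N a b by simp
    finally have eq: "qform A ?y = of_real (a * N * t\<^sup>2 + b * c\<^sup>2 - 2 * t * c * N)" .
    have "0 \<le> qform A ?y" using assms unfolding psd_iff by blast
    then show ?thesis unfolding eq by (simp only: less_eq_complex_def Re_complex_of_real zero_complex.sel)
  qed
  have "N \<ge> 0" by (simp add: a_b_N_def)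
  show ?thesis
  proof (cases "a = 0")
    case True
    have "N = 0"
    proof (rule ccontr)
      assume "N \<noteq> 0"
      \<comment> \<open>This choice of \<open>t\<close> makes the form equal to
        \<open>b - (b + 1) = -1\<close>.\<close>
      with key[of "(b + 1) / (2 * N)" 1] True show False by simp
    qed
    then show ?thesis using True by (simp add: a_b_N_def)
  next
    case False
    have "0 \<le> a * (a * b - N)" using key[of 1 a] by (simp add: algebra_simps power2_eq_square)
    with False a have "N \<le> a * b" by (simp add: zero_le_mult_iff)
    then show ?thesis by (simp add: a_b_N_def)
  qed
qed

text \<open>Bounding every entry by the diagonal reduces positivity for arbitrary \<open>A\<close>
  to an inequality in the diagonal entries and the moduli of \<open>y\<close>.\<close>

lemma psd_qform_le:
  assumes "psd A"
  shows "Re (qform A y) \<le> (\<Sum>i\<in>UNIV. sqrt (Re (A$i$i)) * cmod (y i))\<^sup>2"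
proof -
  have "cmod (A$i$j) \<le> sqrt (Re (A$i$i)) * sqrt (Re (A$j$j))" for i j
    using psd_entry_bound[OF assms, of i j] by (simp add: real_le_rsqrt flip: real_sqrt_mult)
  then have "cmod (y i) * cmod (A$i$j) * cmod (y j) \<le> cmod (y i) * (sqrt (Re (A$i$i)) * sqrt (Re (A$j$j))) * cmod (y j)" for i j
    by (intro mult_right_mono mult_left_mono) auto
  then have le: "cmod (cnj (y i) * A$i$j * y j) \<le> (sqrt (Re (A$i$i)) * cmod (y i)) * (sqrt (Re (A$j$j)) * cmod (y j))" for i j
    by (simp add: norm_mult mult_ac)
  have "Re (qform A y) \<le> cmod (qform A y)" by (rule complex_Re_le_cmod)
  also have "\<dots> \<le> (\<Sum>i\<in>UNIV. \<Sum>j\<in>UNIV. cmod (cnj (y i) * A$i$j * y j))"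
    unfolding qform_def by (intro sum_norm_le norm_sum)
  also have "\<dots> \<le> (\<Sum>i\<in>UNIV. \<Sum>j\<in>UNIV. (sqrt (Re (A$i$i)) * cmod (y i)) * (sqrt (Re (A$j$j)) * cmod (y j)))"
    by (intro sum_mono le)
  also have "\<dots> = (\<Sum>i\<in>UNIV. sqrt (Re (A$i$i)) * cmod (y i))\<^sup>2"
    by (simp add: power2_eq_square sum_product)
  finally show ?thesis .
qed

lemma cyclic_fraction_sum_le_1:
  fixes a b c d :: real
  assumes "a \<ge> 0" "b \<ge> 0" "c \<ge> 0" "d \<ge> 0"
  shows "a / (3 * a + b) + b / (3 * b + c) + c / (3 * c + d) + d / (3 * d + a) \<le> 1"
proof (cases "a > 0 \<and> b > 0 \<and> c > 0 \<and> d > 0")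
  case False
  \<comment> \<open>A zero variable makes its own fraction 0, also in the case 0/0 = 0, and the
    other three are at most 1/3 each.\<close>
  have "u / (3 * u + v) \<le> 1 / 3" if "u \<ge> 0" "v \<ge> 0" for u v :: real
    using that by (cases "u = 0") (auto simp: divide_simps)
  from this[of a b] this[of b c] this[of c d] this[of d a] assms
  have "a / (3 * a + b) \<le> 1 / 3" "b / (3 * b + c) \<le> 1 / 3" "c / (3 * c + d) \<le> 1 / 3" "d / (3 * d + a) \<le> 1 / 3"
    by simp_all
  moreover have "a / (3 * a + b) = 0 \<or> b / (3 * b + c) = 0 \<or> c / (3 * c + d) = 0 \<or> d / (3 * d + a) = 0"
    using False assms by auto
  ultimately show ?thesis by linarith
next
  case True
  \<comment> \<open>With product 1, the claim becomes \<open>27 \<le> 1 + 3 e\<^sub>2 + 2 e\<^sub>3\<close> in the elementary symmetric polynomials.\<close>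
  define p q r t where "p = b / a" "q = c / b" "r = d / c" "t = a / d"
  have pos: "p > 0" "q > 0" "r > 0" "t > 0" and prod: "p * q * r * t = 1"
    using True by (auto simp: p_q_r_t_def)
  have frac: "u / (3 * u + v) = 1 / (3 + v / u)" if "u > 0" for u v :: real
    using that by (simp add: field_simps)
  have amgm: "u + v \<ge> 2 * n" if "u > 0" "v > 0" "u * v \<ge> n\<^sup>2" for u v n :: real
  proof -
    have "(u + v)\<^sup>2 \<ge> (2 * n)\<^sup>2"
      using that(3) sum_squares_bound[of u v] by (simp add: power2_sum power_mult_distrib)
    then show ?thesis by (rule power2_le_imp_le) (use that in simp)
  qed
  have pairs: "(p*q) * (r*t) = 1" "(p*r) * (q*t) = 1" "(p*t) * (q*r) = 1"
    using prod by (simp_all add: mult_ac)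
  have e2: "p*q + r*t \<ge> 2" "p*r + q*t \<ge> 2" "p*t + q*r \<ge> 2"
    using amgm[of "p*q" "r*t" 1] amgm[of "p*r" "q*t" 1] amgm[of "p*t" "q*r" 1] pos pairs by simp_all
  \<comment> \<open>Grouped in two halves, the sum has product of halves
    \<open>(r + t) * (p + q)\<close>, which is at least 4 by the last two bounds of
    \<open>e2\<close>.\<close>
  have e3: "p*q*r + p*q*t + p*r*t + q*r*t \<ge> 4"
  proof -
    have "(p*q*r + p*q*t) * (p*r*t + q*r*t) = (p * q * r * t) * ((r + t) * (p + q))"
      by (simp add: algebra_simps)
    also have "\<dots> = (r + t) * (p + q)" by (simp only: prod mult_1)
    also have "\<dots> \<ge> 2\<^sup>2" using e2(2,3) by (simp add: algebra_simps)
    finally show ?thesis using amgm[of "p*q*r + p*q*t" "p*r*t + q*r*t" 2] pos by (simp add: add_pos_pos)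
  qed
  have "(3+q)*(3+r)*(3+t) + (3+p)*(3+r)*(3+t) + (3+p)*(3+q)*(3+t) + (3+p)*(3+q)*(3+r)
      \<le> (3+p)*(3+q)*(3+r)*(3+t)"
    using e2 e3 prod by (simp add: algebra_simps)
  then have "1 / (3 + p) + 1 / (3 + q) + 1 / (3 + r) + 1 / (3 + t) \<le> 1"
    using pos by (simp add: divide_simps add_pos_pos) (simp add: algebra_simps)
  then show ?thesis using True by (simp add: frac p_q_r_t_def)
qed

text \<open>Cauchy-Schwarz with weights \<open>D i\<close>; where \<open>D i\<close> is 0, so is
  \<open>a i\<close>, and the splitting remains valid.\<close>

lemma cyclic_cauchy_schwarz:
  fixes a w :: "4 \<Rightarrow> real"
  assumes "s \<in> {1, 3}" and a: "\<And>i. a i \<ge> 0"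
  shows "(\<Sum>i\<in>UNIV. sqrt (a i) * w i)\<^sup>2 \<le> (\<Sum>i\<in>UNIV. (3 * a i + a (i + s)) * (w i)\<^sup>2)"
proof -
  define D where "D i = 3 * a i + a (i + s)" for i
  have D: "D i \<ge> 0" for i using a by (simp add: D_def)
  have split: "sqrt (a i) * w i = (sqrt (D i) * w i) * sqrt (a i / D i)" for i
  proof (cases "D i = 0")
    case True
    then have "a i = 0" using a[of i] a[of "i + s"] by (simp add: D_def)
    then show ?thesis by simp
  next
    case False
    then show ?thesis by (simp add: real_sqrt_divide)
  qed
  have "(\<Sum>i\<in>UNIV. sqrt (a i) * w i)\<^sup>2 \<le> (\<Sum>i\<in>UNIV. (sqrt (D i) * w i)\<^sup>2) * (\<Sum>i\<in>UNIV. (sqrt (a i / D i))\<^sup>2)"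
    unfolding split by (rule Cauchy_Schwarz_ineq_sum)
  also have "\<dots> = (\<Sum>i\<in>UNIV. D i * (w i)\<^sup>2) * (\<Sum>i\<in>UNIV. a i / D i)"
    using D a by (simp add: power_mult_distrib)
  also have "\<dots> \<le> (\<Sum>i\<in>UNIV. D i * (w i)\<^sup>2) * 1"
  proof (rule mult_left_mono)
    show "(\<Sum>i\<in>UNIV. a i / D i) \<le> 1"
      \<comment> \<open>For \<open>s = 3\<close> the cycle is traversed backwards, hence the
        reversed arguments.\<close>
      using assms(1) cyclic_fraction_sum_le_1[of "a 1" "a 2" "a 3" "a 4"] 
        cyclic_fraction_sum_le_1[of "a 4" "a 3" "a 2" "a 1"] a
      by (elim insertE emptyE) (simp_all add: D_def sum_4 mod4 add_ac)
    show "0 \<le> (\<Sum>i\<in>UNIV. D i * (w i)\<^sup>2)" using D by (intro sum_nonneg) simp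
  qed
  finally show ?thesis by (simp add: D_def)
qed

lemma qform_Phi4:
  "qform (Phi4 k A) y = (\<Sum>i\<in>UNIV. (3 * A$i$i + A$(i + of_nat k)$(i + of_nat k)) * of_real ((cmod (y i))\<^sup>2)) - qform A y"
proof -
  have "cnj (y i) * Phi4 k A $ i $ j * y j
     = (if j = i then (3 * A$i$i + A$(i + of_nat k)$(i + of_nat k)) * of_real ((cmod (y i))\<^sup>2) else 0) - cnj (y i) * A$i$j * y j" for i j
    by (simp add: Phi4_def complex_norm_square algebra_simps del: of_real_power)
  then show ?thesis by (simp add: qform_def sum_subtractf)
qed

lemma clinear_map_Phi4: "clinear_map (Phi4 k)"
  by (auto simp: clinear_map_def Phi4_def mscale_def vec_eq_iff algebra_simps)

lemma positive_map_Phi4: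
  assumes "of_nat k \<in> {1, 3 :: 4}"
  shows "positive_map (Phi4 k)"
  unfolding positive_map_def
proof (intro allI impI)
  fix A :: "complex^4^4" assume A: "psd A"
  let ?a = "\<lambda>i. Re (A$i$i)"
  have herm: "cnj (A$j$i) = A$i$j" for i j using A by (simp add: psd_iff)
  have "0 \<le> qform (Phi4 k A) y" for y
  proof -
    have eq: "qform (Phi4 k A) y = of_real (\<Sum>i\<in>UNIV. (3 * ?a i + ?a (i + of_nat k)) * (cmod (y i))\<^sup>2) - qform A y"
      by (simp add: qform_Phi4 flip: psd_diag(2)[OF A])
    have "Re (qform A y) \<le> (\<Sum>i\<in>UNIV. (3 * ?a i + ?a (i + of_nat k)) * (cmod (y i))\<^sup>2)"
      using psd_qform_le[OF A, of y] cyclic_cauchy_schwarz[OF assms, of ?a "\<lambda>i. cmod (y i)"] psd_diag(1)[OF A]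
      by force
    moreover have "Im (qform A y) = 0" using A by (simp add: psd_iff less_eq_complex_def)
    ultimately show ?thesis unfolding eq by (simp add: less_eq_complex_def)
  qed
  moreover have "cnj (Phi4 k A $ j $ i) = Phi4 k A $ i $ j" for i j
    by (simp add: Phi4_def herm)
  ultimately show "psd (Phi4 k A)" by (simp add: psd_iff)
qed

section \<open>Extremality\<close>

definition munit :: "'n \<Rightarrow> 'n \<Rightarrow> complex^'n^'n" where
  "munit j k = (\<chi> a b. if a = j \<and> b = k then 1 else 0)"

definition outer :: "('n \<Rightarrow> complex) \<Rightarrow> complex^'n^'n" where
  "outer x = (\<chi> i j. x i * cnj (x j))"

lemma outer_nth: "outer x $ i $ j = x i * cnj (x j)"
  by (simp add: outer_def)

lemma qform_outer: "qform (outer x) y = of_real ((cmod (\<Sum>i\<in>UNIV. x i * cnj (y i)))\<^sup>2)"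
  unfolding complex_norm_square qform_def outer_def
  by (simp add: sum_product mult_ac)

lemma psd_outer: "psd (outer x)"
  by (simp add: psd_iff qform_outer less_eq_complex_def del: of_real_power) (simp add: outer_def)

lemma clinear_map_sum:
  assumes "clinear_map \<psi>"
  shows "\<psi> (sum f S) = (\<Sum>i\<in>S. \<psi> (f i))"
proof -
  interpret additive \<psi> by standard (use assms in \<open>simp add: clinear_map_def\<close>)
  show ?thesis by (rule sum)
qed

lemma clinear_map_entry:
  fixes A :: "complex^'n::finite^'n"
  assumes "clinear_map \<psi>"
  shows "\<psi> A $ l $ m = (\<Sum>j\<in>UNIV. \<Sum>k\<in>UNIV. A$j$k * \<psi> (munit j k) $ l $ m)"
proof -
  have "munit j k $ a $ b = (if b = k then if a = j then 1 else 0 else 0)" for j k a b :: 'n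
    by (simp add: munit_def)
  then have "A = (\<Sum>j\<in>UNIV. \<Sum>k\<in>UNIV. mscale (A$j$k) (munit j k))"
    by (simp add: vec_eq_iff mscale_def mult_delta_right)
  then have "\<psi> A = (\<Sum>j\<in>UNIV. \<Sum>k\<in>UNIV. \<psi> (mscale (A$j$k) (munit j k)))"
    using assms by (metis (no_types, lifting) clinear_map_sum sum.cong)
  then show ?thesis using assms by (simp add: clinear_map_def mscale_def)
qed

lemma qform_map_outer:
  assumes "clinear_map \<psi>"
  shows "qform (\<psi> (outer x)) y = tform (\<lambda>j k l m. \<psi> (munit j k) $ l $ m) x y"
  unfolding tform_swap qform_def
  by (simp add: clinear_map_entry[OF assms, of "outer x"] outer_nth mult_ac)

lemma qform_Phi4_outer: "qform (Phi4 k (outer x)) y = of_real (gform (of_nat k) x y)"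
  unfolding qform_Phi4 qform_outer gform_def
  by (simp add: outer_def flip: complex_norm_square of_real_power)

lemma qform_add: "qform (A + B) y = qform A y + qform B y"
  by (simp add: qform_def sum.distrib ring_distribs)

text \<open>Positivity of both summands on the rank-one matrices \<open>outer x\<close> is dominance
  of the coefficients of \<open>\<psi>\<close>, which \<open>dominated_unique\<close> then
  identifies on matrix units.\<close>

lemma Phi4_summand_proportional:
  assumes s: "of_nat k \<in> {1, 3 :: 4}"
    and \<psi>: "clinear_map \<psi>" "positive_map \<psi>" and "positive_map \<psi>'"
    and sum: "\<And>A. Phi4 k A = \<psi> A + \<psi>' A"
  shows "\<exists>t::real. t \<ge> 0 \<and> (\<forall>A. \<psi> A = mscale (of_real t) (Phi4 k A))"
proof -
  let ?c = "\<lambda>j k l m. \<psi> (munit j k) $ l $ m"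
  have "dominated (of_nat k) ?c"
    unfolding dominated_def
  proof (intro allI)
    fix x y :: "4 \<Rightarrow> complex"
    have "0 \<le> qform (\<psi> (outer x)) y" "0 \<le> qform (\<psi>' (outer x)) y"
      using \<psi> \<open>positive_map \<psi>'\<close> psd_outer[of x] by (simp_all add: positive_map_def psd_iff)
    moreover have "of_real (gform (of_nat k) x y) = qform (\<psi> (outer x)) y + qform (\<psi>' (outer x)) y"
      by (simp add: sum qform_add flip: qform_Phi4_outer)
    ultimately show "0 \<le> tform ?c x y \<and> tform ?c x y \<le> complex_of_real (gform (of_nat k) x y)"
      by (simp flip: qform_map_outer[OF \<psi>(1)])
  qed
  from dominated_unique[OF s this] obtain t :: real where "t \<ge> 0" and c:
    "\<And>i j l m. \<psi> (munit i j) $ l $ m = of_real t * ((if i = j \<and> l = m then (if i = l then 3 else 0) + (if i = l + of_nat k then 1 else 0) else 0)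
       - (if i = l \<and> j = m then 1 else 0))" by blast
  have unit: "\<psi> (munit i j) $ l $ m = of_real t * Phi4 k (munit i j) $ l $ m" for i j l m
    unfolding c by (auto simp: Phi4_def munit_def)
  have "\<psi> A = mscale (of_real t) (Phi4 k A)" for A
    unfolding vec_eq_iff clinear_map_entry[OF \<psi>(1), of A] mscale_def clinear_map_entry[OF clinear_map_Phi4, of k A]
    by (simp add: unit clinear_map_entry[OF clinear_map_Phi4, of k A] sum_distrib_left mult_ac)
  with \<open>t \<ge> 0\<close> show ?thesis by blast
qed

lemma extremal_Phi4:
  assumes "of_nat k \<in> {1, 3 :: 4}"
  shows "extremal_positive (Phi4 k)"
  unfolding extremal_positive_def
proof (intro conjI allI impI)
  show "clinear_map (Phi4 k)" by (rule clinear_map_Phi4)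
  show "positive_map (Phi4 k)" by (rule positive_map_Phi4[OF assms])
  fix \<psi> \<psi>' assume *: "clinear_map \<psi> \<and> positive_map \<psi> \<and> clinear_map \<psi>' \<and> positive_map \<psi>' \<and>
      (\<forall>A. Phi4 k A = \<psi> A + \<psi>' A)"
  then have "\<exists>l1::real. l1 \<ge> 0 \<and> (\<forall>A. \<psi> A = mscale (of_real l1) (Phi4 k A))"
    by (intro Phi4_summand_proportional[OF assms, of \<psi> \<psi>']) auto
  moreover have "\<exists>l2::real. l2 \<ge> 0 \<and> (\<forall>A. \<psi>' A = mscale (of_real l2) (Phi4 k A))"
    using * by (intro Phi4_summand_proportional[OF assms, of \<psi>' \<psi>]) (auto simp: add.commute)
  ultimately show "\<exists>l1 l2::real. l1 \<ge> 0 \<and> l2 \<ge> 0 \<and>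
      (\<forall>A. \<psi> A = mscale (complex_of_real l1) (Phi4 k A)) \<and>
      (\<forall>A. \<psi>' A = mscale (complex_of_real l2) (Phi4 k A))"
    by blast
qed

section \<open>Decomposition for \<open>k = 2\<close>\<close>

definition cp_part :: "complex^4^4 \<Rightarrow> complex^4^4" where
  "cp_part A = (\<chi> i j. if i = j then 2 * A$i$i else if j = i + 2 then 0 else - A$i$j)"

text \<open>On each index pair \<open>{i, i + 2}\<close> this is the adjugate of the corresponding
  2x2 block of \<open>A\<close>.\<close>

definition cocp_part :: "complex^4^4 \<Rightarrow> complex^4^4" where
  "cocp_part A = (\<chi> i j. if i = j then A$(i + 2)$(i + 2) else if j = i + 2 then - A$i$j else 0)"

text \<open>The map is a Schur product with a matrix that is the sum of the rank-one matrices of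
  (1,-1,1,-1), (1,0,-1,0) and (0,1,0,-1).\<close>

lemma psd_cp_part:
  assumes "psd A"
  shows "psd (cp_part A)"
proof -
  define v :: "complex \<Rightarrow> complex \<Rightarrow> complex \<Rightarrow> complex \<Rightarrow> 4 \<Rightarrow> complex"
    where "v a b c d i = (if i = 1 then a else if i = 2 then b else if i = 3 then c else d)" for a b c d i
  have "qform (cp_part A) y = qform A (\<lambda>i. v 1 (-1) 1 (-1) i * y i) + qform A (\<lambda>i. v 1 0 (-1) 0 i * y i)
      + qform A (\<lambda>i. v 0 1 0 (-1) i * y i)" for y
    by (simp add: qform_def sum_4 cp_part_def v_def mod4)
  moreover have "cnj (cp_part A $ j $ i) = cp_part A $ i $ j" for i j
    using assms exhaust_4[of i] exhaust_4[of j] unfolding psd_iff cp_part_def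
    by (elim disjE) (simp_all add: mod4)
  ultimately show ?thesis using assms by (simp add: psd_iff)
qed

text \<open>The adjugate of a 2x2 block is its transpose conjugated by a rotation; the transpose
  accounts for the \<open>cnj\<close> in the test vectors.\<close>

lemma psd_cocp_part:
  assumes "psd A"
  shows "psd (cocp_part A)"
proof -
  define v :: "complex \<Rightarrow> complex \<Rightarrow> complex \<Rightarrow> complex \<Rightarrow> 4 \<Rightarrow> complex"
    where "v a b c d i = (if i = 1 then a else if i = 2 then b else if i = 3 then c else d)" for a b c d i
  have "qform (cocp_part A) y = qform A (v (cnj (y 3)) 0 (- cnj (y 1)) 0) + qform A (v 0 (cnj (y 4)) 0 (- cnj (y 2)))" for y
    by (simp add: qform_def sum_4 cocp_part_def v_def mod4)
  moreover have "cnj (cocp_part A $ j $ i) = cocp_part A $ i $ j" for i j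
    using assms exhaust_4[of i] exhaust_4[of j] unfolding psd_iff cocp_part_def
    by (elim disjE) (simp_all add: mod4)
  ultimately show ?thesis using assms by (simp add: psd_iff)
qed

lemma not_extremal_Phi4_2: "\<not> extremal_positive (Phi4 2)"
proof
  assume "extremal_positive (Phi4 2)"
  moreover have "clinear_map cp_part" "clinear_map cocp_part"
    by (auto simp: clinear_map_def cp_part_def cocp_part_def mscale_def vec_eq_iff algebra_simps)
  moreover have "positive_map cp_part" "positive_map cocp_part"
    by (simp_all add: positive_map_def psd_cp_part psd_cocp_part)
  moreover have "Phi4 2 A = cp_part A + cocp_part A" for A
    by (simp add: vec_eq_iff Phi4_def cp_part_def cocp_part_def)
  ultimately obtain l :: real where l: "cocp_part A = mscale (complex_of_real l) (Phi4 2 A)" for A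
    unfolding extremal_positive_def by blast
  \<comment> \<open>The image of the matrix unit at (1,1) has diagonal entries 0 at 1 and 1 at 3
    under \<open>cocp_part\<close>, but 2 and 1 under \<open>Phi4 2\<close>.\<close>
  have "l = 0" 
    using arg_cong[OF l[of "munit 1 1"], of "\<lambda>B. B$1$1"]
    by (simp add: cocp_part_def mscale_def Phi4_def munit_def mod4)
  moreover have "l = 1"
    using arg_cong[OF l[of "munit 1 1"], of "\<lambda>B. B$3$3"]
    by (simp add: cocp_part_def mscale_def Phi4_def munit_def mod4)
  ultimately show False by simp
qed

theorem theorem3:
  fixes k :: nat
  assumes "k \<in> {1, 2, 3}"
  shows "extremal_positive (Phi4 k) \<longleftrightarrow> (k = 1 \<or> k = 3)"
  using assms not_extremal_Phi4_2 extremal_Phi4[of 1] extremal_Phi4[of 3] by auto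

end
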